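(* Let $r$ be a positive integer or $r=\infty$. The function $a_r$ is multiplicative: $a_r(mn)=a_r(m)a_r(n)$ for all positive integers $m,n$ with $(m,n)=1$.
   Context: For an isomorphism class $G$ of finite Abelian groups, a group-partition of $G$ is a sequence $(G_1,G_2,G_3,\dots)$ of isomorphism classes of finite Abelian groups (all but finitely many trivial) such that $G=G_1\oplus G_2\oplus G_3\oplus\cdots$ and $G_1\supseteq G_2\supseteq G_3\supseteq\cdots$, where $G_i\supseteq G_{i+1}$ means that $G_{i+1}$ is isomorphic to a subgroup of $G_i$. For a positive integer $r$, $\pi_r(G)$ is the number of group-partitions of $G$ with at most $r$ factors (i.e. at most $r$ nontrivial $G_i$), and $\pi_\infty(G)$ is the number of all group-partitions of $G$. For $n\ge 1$ and $r\in\{1,2,3,\dots\}\cup\{\infty\}$, put $a_r(n):=\sum_{|G|=n}\pi_r(G)$, where $G$ runs over the isomorphism classes of Abelian groups of order $n$. *)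

theory Defs
  imports "HOL-Algebra.Algebra" "HOL-Library.Extended_Nat"
begin

text \<open>Isomorphism classes of finite Abelian groups. Every finite group is isomorphic to one whose
  carrier is a set of natural numbers, so the classes are taken inside the type
  \<^typ>\<open>nat monoid\<close>; see \<open>finite_abelian_group_representable\<close> below.\<close>

definition finite_abelian_groups :: "nat monoid set" where
  "finite_abelian_groups = {G. comm_group G \<and> finite (carrier G)}"

definition group_iso_rel :: "(nat monoid \<times> nat monoid) set" where
  "group_iso_rel =
     {(G, H). G \<in> finite_abelian_groups \<and> H \<in> finite_abelian_groups \<and> G \<cong> H}"

type_synonym iso_class = "nat monoid set"

definition iso_classes :: "iso_class set" where
  "iso_classes = finite_abelian_groups // group_iso_rel"

text \<open>The following notions on classes are given through representatives; all of them are invariant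
  under isomorphism, so the choice of representatives is immaterial.\<close>

definition class_has_order :: "iso_class \<Rightarrow> nat \<Rightarrow> bool" where
  "class_has_order C n \<longleftrightarrow> (\<exists>G\<in>C. order G = n)"

definition class_trivial :: "iso_class \<Rightarrow> bool" where
  "class_trivial C \<longleftrightarrow> (\<exists>G\<in>C. trivial_group G)"

definition class_contains :: "iso_class \<Rightarrow> iso_class \<Rightarrow> bool" where
  "class_contains C D \<longleftrightarrow> (\<exists>G\<in>C. \<exists>H\<in>D. \<exists>K. subgroup K G \<and> H \<cong> G\<lparr>carrier := K\<rparr>)"

text \<open>\<^const>\<open>sum_group\<close> is the direct sum: the finitely supported elements of the product.\<close>

definition class_is_direct_sum :: "iso_class \<Rightarrow> (nat \<Rightarrow> iso_class) \<Rightarrow> bool" where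
  "class_is_direct_sum C P \<longleftrightarrow>
     (\<exists>G\<in>C. \<exists>g. (\<forall>i. g i \<in> P i) \<and> G \<cong> sum_group UNIV g)"

text \<open>A group-partition \<open>(G\<^sub>1, G\<^sub>2, \<dots>)\<close> is indexed from \<open>0\<close>: \<open>P i\<close> is the class \<open>G\<^bsub>i+1\<^esub>\<close>.\<close>

definition group_partition :: "iso_class \<Rightarrow> (nat \<Rightarrow> iso_class) \<Rightarrow> bool" where
  "group_partition C P \<longleftrightarrow>
     (\<forall>i. P i \<in> iso_classes) \<and>
     finite {i. \<not> class_trivial (P i)} \<and>
     class_is_direct_sum C P \<and>
     (\<forall>i. class_contains (P i) (P (Suc i)))"

text \<open>The bound \<open>r\<close> ranges over \<^typ>\<open>enat\<close>; for \<open>r = \<infinity>\<close> the last condition is vacuous.\<close>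

definition num_group_partitions :: "enat \<Rightarrow> iso_class \<Rightarrow> nat" where
  "num_group_partitions r C =
     card {P. group_partition C P \<and> enat (card {i. \<not> class_trivial (P i)}) \<le> r}"

text \<open>This is \<open>a\<^sub>r(n)\<close>.\<close>

definition partition_sum :: "enat \<Rightarrow> nat \<Rightarrow> nat" where
  "partition_sum r n = (\<Sum>C | C \<in> iso_classes \<and> class_has_order C n. num_group_partitions r C)"

lemma finite_abelian_group_representable:
  fixes G :: "('a, 'b) monoid_scheme"
  assumes "comm_group G" "finite (carrier G)"
  shows "\<exists>H\<in>finite_abelian_groups. G \<cong> H"
proof -
  interpret G: comm_group G by fact
  obtain f :: "'a \<Rightarrow> nat" where f: "inj_on f (carrier G)"
    using finite_imp_inj_to_nat_seg[OF assms(2)] by auto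
  define g where "g = inv_into (carrier G) f"
  have gf: "g (f x) = x" if "x \<in> carrier G" for x
    using f that by (simp add: g_def)
  define H :: "nat monoid" where
    "H = \<lparr>carrier = f ` carrier G, monoid.mult = (\<lambda>x y. f (g x \<otimes>\<^bsub>G\<^esub> g y)), one = f \<one>\<^bsub>G\<^esub>\<rparr>"
  have "comm_group H"
  proof (rule comm_groupI)
    fix x assume "x \<in> carrier H"
    then obtain u where u: "u \<in> carrier G" "x = f u" by (auto simp: H_def)
    then have "f (inv\<^bsub>G\<^esub> u) \<in> carrier H" "f (inv\<^bsub>G\<^esub> u) \<otimes>\<^bsub>H\<^esub> x = \<one>\<^bsub>H\<^esub>"
      by (auto simp: H_def gf)
    then show "\<exists>y\<in>carrier H. y \<otimes>\<^bsub>H\<^esub> x = \<one>\<^bsub>H\<^esub>" by blast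
  qed (auto simp: H_def gf G.m_ac)
  moreover have "f \<in> iso G H"
    using f by (auto simp: iso_def hom_def bij_betw_def H_def gf)
  ultimately show ?thesis
    using assms(2) by (auto simp: finite_abelian_groups_def is_iso_def H_def)
qed

lemma equiv_group_iso_rel: "equiv finite_abelian_groups group_iso_rel"
proof (rule equivI)
  show "group_iso_rel \<subseteq> finite_abelian_groups \<times> finite_abelian_groups"
    by (auto simp: group_iso_rel_def)
  show "refl_on finite_abelian_groups group_iso_rel"
    by (auto simp: refl_on_def group_iso_rel_def)
  show "sym group_iso_rel"
    by (auto simp: sym_def group_iso_rel_def finite_abelian_groups_def comm_group_def
        intro: group.iso_sym)
  show "trans group_iso_rel"
    by (auto simp: trans_def group_iso_rel_def intro: iso_trans)
qed

end

theory Submission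
  imports Defs
begin

text \<open>For coprime \<open>m\<close> and \<open>n\<close>, an abelian group \<open>G\<close> killed by \<open>m n\<close> is the direct sum of its
  \<open>m\<close>-torsion and its \<open>n\<close>-torsion. Taking torsion respects isomorphisms, embeddings and direct sums,
  and so does forming products, so that group-partitions of \<open>G\<close> correspond to pairs of
  group-partitions of the two torsion parts. The nontrivial factors of a group-partition form an
  initial segment, hence the product of two group-partitions has as many nontrivial factors as the
  longer of the two, and the correspondence respects the bound \<open>r\<close>. Finally, by Cauchy's theorem the
  torsion parts of a group of order \<open>m n\<close> have order \<open>m\<close> and \<open>n\<close>.\<close>

subsection \<open>Torsion subgroups\<close>

definition torsion :: "nat \<Rightarrow> ('a, 'b) monoid_scheme \<Rightarrow> ('a, 'b) monoid_scheme" where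
  "torsion k G = G\<lparr>carrier := {x \<in> carrier G. x [^]\<^bsub>G\<^esub> k = \<one>\<^bsub>G\<^esub>}\<rparr>"

text \<open>The exponent of \<open>G\<close> divides \<open>k\<close>. The factors of a
  group-partition have unprescribed orders but inherit this condition from the whole group, so the
  splitting is stated with exponents instead of orders.\<close>

definition bounded_exponent :: "nat \<Rightarrow> ('a, 'b) monoid_scheme \<Rightarrow> bool" where
  "bounded_exponent k G \<longleftrightarrow> (\<forall>x\<in>carrier G. x [^]\<^bsub>G\<^esub> k = \<one>\<^bsub>G\<^esub>)"

lemma carrier_torsion: "carrier (torsion k G) = {x \<in> carrier G. x [^]\<^bsub>G\<^esub> k = \<one>\<^bsub>G\<^esub>}"
  and one_torsion [simp]: "\<one>\<^bsub>torsion k G\<^esub> = \<one>\<^bsub>G\<^esub>"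
  and mult_torsion [simp]: "(\<otimes>\<^bsub>torsion k G\<^esub>) = (\<otimes>\<^bsub>G\<^esub>)"
  by (simp_all add: torsion_def)

lemma pow_torsion [simp]: "x [^]\<^bsub>torsion k G\<^esub> (n::nat) = x [^]\<^bsub>G\<^esub> n"
  by (simp add: torsion_def nat_pow_def)

lemma bounded_exponent_order:
  assumes "group G" shows "bounded_exponent (order G) G"
  using assms by (simp add: bounded_exponent_def group.pow_order_eq_1)

lemma bounded_exponent_mon:
  assumes "f \<in> mon G H" "group G" "group H" "bounded_exponent k H"
  shows "bounded_exponent k G"
  unfolding bounded_exponent_def
proof
  fix x assume x: "x \<in> carrier G"
  interpret G: group G by fact
  have f: "f \<in> hom G H" "inj_on f (carrier G)" using assms by (auto simp: mon_def)
  have "f (x [^]\<^bsub>G\<^esub> k) = \<one>\<^bsub>H\<^esub>"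
    using assms x f by (simp add: hom_nat_pow bounded_exponent_def hom_in_carrier)
  also have "\<dots> = f \<one>\<^bsub>G\<^esub>" using f assms by (simp add: hom_one)
  finally show "x [^]\<^bsub>G\<^esub> k = \<one>\<^bsub>G\<^esub>" using f x by (simp add: inj_on_eq_iff)
qed

lemma (in comm_group) subgroup_torsion: "subgroup (carrier (torsion k G)) G"
  by (rule subgroupI) (auto simp: carrier_torsion nat_pow_distrib nat_pow_inv)

lemma comm_group_subgroup:
  assumes "comm_group G" "subgroup K G"
  shows "comm_group (G\<lparr>carrier := K\<rparr>)"
proof -
  interpret comm_group G by fact
  show ?thesis
    using subgroup_imp_group[OF assms(2)] subgroup.subset[OF assms(2)]
    by (auto intro!: group.group_comm_groupI simp: m_comm subset_iff)
qed

lemma comm_group_torsion: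
  assumes "comm_group G" shows "comm_group (torsion k G)"
proof -
  have "torsion k G = G\<lparr>carrier := carrier (torsion k G)\<rparr>" by (simp add: torsion_def)
  then show ?thesis
    using comm_group_subgroup[OF assms comm_group.subgroup_torsion[OF assms]] by metis
qed

lemma group_torsion: "comm_group G \<Longrightarrow> group (torsion k G)"
  using comm_group_torsion comm_group_def by blast

text \<open>Homomorphisms preserve the equation defining torsion, and a restriction of an injective
  map is injective. This carries the containments between consecutive factors over to their torsion
  parts.\<close>

lemma mon_torsion:
  assumes "f \<in> mon G H" "group G" "group H"
  shows "f \<in> mon (torsion k G) (torsion k H)"
proof -
  have f: "f \<in> hom G H" "inj_on f (carrier G)" using assms by (auto simp: mon_def)
  have "f x [^]\<^bsub>H\<^esub> k = \<one>\<^bsub>H\<^esub>" if "x \<in> carrier (torsion k G)" for x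
    using that assms f
    by (auto simp: carrier_torsion hom_one simp flip: hom_nat_pow)
  then show ?thesis
    using f by (auto simp: mon_def hom_def carrier_torsion inj_on_def)
qed

lemma iso_torsion:
  assumes "G \<cong> H" "group G" "group H"
  shows "torsion k G \<cong> torsion k H"
proof -
  obtain f where f: "f \<in> iso G H" using assms by (auto simp: is_iso_def)
  then have hom: "f \<in> hom G H" "inj_on f (carrier G)" "f ` carrier G = carrier H"
    by (auto simp: iso_iff)
  \<comment> \<open>The converse direction, from injectivity of \<open>f\<close>: preimages of
    \<open>k\<close>-torsion elements are \<open>k\<close>-torsion, so \<open>f\<close> maps torsion
    onto torsion.\<close>
  have *: "x [^]\<^bsub>G\<^esub> k = \<one>\<^bsub>G\<^esub>" if "x \<in> carrier G" "f x [^]\<^bsub>H\<^esub> k = \<one>\<^bsub>H\<^esub>" for x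
  proof -
    interpret G: group G by fact
    have "f (x [^]\<^bsub>G\<^esub> k) = f \<one>\<^bsub>G\<^esub>"
      using that hom assms by (simp add: hom_nat_pow hom_one)
    then show ?thesis using hom that by (simp add: inj_on_eq_iff)
  qed
  have "f \<in> mon (torsion k G) (torsion k H)"
    using f assms by (intro mon_torsion) (auto simp: iso_iff_mon_epi)
  moreover have "carrier (torsion k H) \<subseteq> f ` carrier (torsion k G)"
    using hom(3) * by (force simp: carrier_torsion)
  ultimately have "f \<in> iso (torsion k G) (torsion k H)"
    by (auto simp: iso_iff_mon_epi epi_iff_subset mon_def)
  then show ?thesis by (rule is_isoI)
qed

section \<open>Splitting by coprime exponents\<close>

lemma (in group) coprime_pow_eq_one:
  fixes m n :: nat
  assumes "coprime m n" "m > 0" "x \<in> carrier G" "x [^] m = \<one>" "x [^] n = \<one>"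
  shows "x = \<one>"
proof -
  \<comment> \<open>Bezout's identity with natural coefficients, available since
    \<open>m > 0\<close>, keeps all exponents natural.\<close>
  obtain a b where ab: "m * a = n * b + 1"
    using bezout_nat[of m n] assms by auto
  have "\<one> = x [^] (m * a)" using assms by (simp flip: nat_pow_pow)
  also have "\<dots> = x [^] (n * b) \<otimes> x" by (simp add: ab)
  also have "\<dots> = x" using assms by (simp flip: nat_pow_pow)
  finally show ?thesis ..
qed

text \<open>The isomorphism is multiplication. A kernel element \<open>(x, y)\<close> has
  \<open>x = inv y\<close>, so \<open>x\<close> is killed by both \<open>m\<close> and
  \<open>n\<close> and is trivial. For surjectivity take \<open>m * a = n * b + 1\<close>: then
  \<open>x\<close> is the product of \<open>inv (x [^] (n * b))\<close>, killed by \<open>m\<close>,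
  and \<open>x [^] (m * a)\<close>, killed by \<open>n\<close>.\<close>

lemma iso_torsion_DirProd:
  fixes G (structure)
  assumes "comm_group G" "coprime m n" "m > 0" "bounded_exponent (m * n) G"
  shows "torsion m G \<times>\<times> torsion n G \<cong> G"
proof -
  interpret comm_group G by fact
  have exp: "x [^] (m * n) = \<one>" if "x \<in> carrier G" for x
    using assms that by (simp add: bounded_exponent_def)
  let ?P = "torsion m G \<times>\<times> torsion n G" and ?f = "\<lambda>(x, y). x \<otimes> y"
  interpret P: group ?P by (intro DirProd_group group_torsion assms)
  have "?f \<in> hom ?P G"
    by (rule homI) (auto simp: carrier_torsion m_ac)
  then interpret f: group_hom ?P G ?f
    by (simp add: group_hom_def group_hom_axioms_def P.is_group)
  have "inj_on ?f (carrier ?P)"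
  proof (subst f.inj_on_one_iff, clarify)
    fix x y assume "(x, y) \<in> carrier ?P" and xy1: "x \<otimes> y = \<one>"
    then have xy: "x \<in> carrier G" "x [^] m = \<one>" "y \<in> carrier G" "y [^] n = \<one>"
      by (auto simp: carrier_torsion)
    then have x: "x = inv y" using xy1 by (simp add: inv_equality)
    then have "x [^] n = \<one>" using xy by (simp add: nat_pow_inv)
    then have "x = \<one>" using xy assms coprime_pow_eq_one by blast
    then show "(x, y) = \<one>\<^bsub>?P\<^esub>" using xy xy1 by simp
  qed
  moreover have "carrier G \<subseteq> ?f ` carrier ?P"
  proof
    fix x assume x: "x \<in> carrier G"
    obtain a b where ab: "m * a = n * b + 1"
      using bezout_nat[of m n] assms by auto
    have "inv (x [^] (n * b)) [^] m = inv ((x [^] (m * n)) [^] b)"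
      using x by (simp add: nat_pow_pow mult_ac flip: nat_pow_inv)
    moreover have "(x [^] (m * a)) [^] n = (x [^] (m * n)) [^] a"
      using x by (simp add: nat_pow_pow mult_ac)
    ultimately have "(inv (x [^] (n * b)), x [^] (m * a)) \<in> carrier ?P"
      using x exp by (simp add: carrier_torsion)
    moreover have "inv (x [^] (n * b)) \<otimes> x [^] (m * a) = x"
      using x by (simp add: ab flip: m_assoc)
    ultimately show "x \<in> ?f ` carrier ?P"
      by (metis case_prod_conv image_eqI)
  qed
  ultimately have "?f \<in> iso ?P G"
    using f.homh by (auto simp: iso_iff_mon_epi epi_iff_subset mon_def)
  then show ?thesis by (rule is_isoI)
qed

lemma DirProd_mon:
  assumes "f \<in> mon G G'" "g \<in> mon H H'"
  shows "(\<lambda>(x, y). (f x, g y)) \<in> mon (G \<times>\<times> H) (G' \<times>\<times> H')"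
  using assms by (auto simp: mon_def hom_def inj_on_def)

lemma DirProd_iso:
  assumes "G \<cong> G'" "H \<cong> H'" "group G" "group H"
  shows "G \<times>\<times> H \<cong> G' \<times>\<times> H'"
proof -
  obtain f g where "f \<in> iso G G'" "g \<in> iso H H'"
    using assms by (auto simp: is_iso_def)
  then show ?thesis
    using assms iso_paired2 is_isoI by metis
qed

text \<open>If \<open>(x, y)\<close> is killed by \<open>m\<close>, then \<open>y\<close> is killed
  by both \<open>m\<close> and \<open>n\<close>, hence trivial. The \<open>m\<close>-torsion is
  therefore \<open>G\<close> times the trivial subgroup, and \<open>fst\<close> identifies it with
  \<open>G\<close>.\<close>

lemma torsion_DirProd_left:
  assumes "group G" "group H" "coprime m n" "m > 0" "bounded_exponent m G" "bounded_exponent n H"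
  shows "torsion m (G \<times>\<times> H) \<cong> G"
proof -
  interpret G: group G by fact
  interpret H: group H by fact
  have pow: "(x, y) [^]\<^bsub>G \<times>\<times> H\<^esub> k = (x [^]\<^bsub>G\<^esub> k, y [^]\<^bsub>H\<^esub> k)" for x y and k :: nat
    by (induction k) auto
  have one: "y = \<one>\<^bsub>H\<^esub>" if "y \<in> carrier H" "y [^]\<^bsub>H\<^esub> m = \<one>\<^bsub>H\<^esub>" for y
    by (rule H.coprime_pow_eq_one[of m n]) (use that assms in \<open>simp_all add: bounded_exponent_def\<close>)
  have "carrier (torsion m (G \<times>\<times> H)) = carrier G \<times> {\<one>\<^bsub>H\<^esub>}"
    using assms(5) by (auto simp: carrier_torsion pow bounded_exponent_def intro: one)
  then have "fst \<in> iso (torsion m (G \<times>\<times> H)) G"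
    by (auto simp: iso_iff hom_def inj_on_def)
  then show ?thesis by (rule is_isoI)
qed

lemma torsion_DirProd_right:
  assumes "group G" "group H" "coprime m n" "n > 0" "bounded_exponent m G" "bounded_exponent n H"
  shows "torsion n (G \<times>\<times> H) \<cong> H"
proof -
  have "torsion n (G \<times>\<times> H) \<cong> torsion n (H \<times>\<times> G)"
    by (intro iso_torsion DirProd_commute_iso DirProd_group assms(1,2))
  also have "\<dots> \<cong> H"
    by (rule torsion_DirProd_left[OF assms(2,1) coprime_commute[THEN iffD1, OF assms(3)] assms(4,6,5)])
  finally show ?thesis .
qed

section \<open>Orders of the torsion parts\<close>

lemma coprime_order_torsion:
  assumes "comm_group G" "finite (carrier G)" "coprime m n" "m > 0"
  shows "coprime (order (torsion m G)) n"
proof (rule ccontr)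
  assume "\<not> ?thesis"
  then obtain p where p: "Factorial_Ring.prime p" "p dvd order (torsion m G)" "p dvd n"
    using prime_factor_nat[of "gcd (order (torsion m G)) n"] by (auto simp: coprime_iff_gcd_eq_1)
  interpret T: group "torsion m G" by (intro group_torsion assms)
  \<comment> \<open>Sylow's theorem is applied with exponent 1, that is, as Cauchy's theorem, to get
    a subgroup \<open>K\<close> of prime order \<open>p\<close>.\<close>
  obtain l where l: "order (torsion m G) = p ^ 1 * l" using p by (auto elim: dvdE)
  have fin: "finite (carrier (torsion m G))" using assms by (simp add: carrier_torsion)
  obtain K where K: "subgroup K (torsion m G)" "card K = p ^ 1"
    using sylow_thm[OF p(1) T.is_group l fin] by blast
  interpret K: group "torsion m G\<lparr>carrier := K\<rparr>" using K by (simp add: T.subgroup_imp_group)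
  \<comment> \<open>Elements of \<open>K\<close> are killed by \<open>m\<close>, being torsion, and
    by \<open>p\<close>, hence by its multiple \<open>n\<close>. So \<open>K\<close> is trivial,
    against \<open>card K = p\<close>.\<close>
  have "x = \<one>\<^bsub>G\<^esub>" if "x \<in> K" for x
  proof (rule group.coprime_pow_eq_one[OF _ assms(3,4), where G = G, simplified])
    show x: "x \<in> carrier G" and "x [^]\<^bsub>G\<^esub> m = \<one>\<^bsub>G\<^esub>"
      using that K subgroup.subset by (fastforce simp: carrier_torsion)+
    interpret comm_group G by fact
    show "group G" by unfold_locales
    have "x [^]\<^bsub>G\<^esub> p = \<one>\<^bsub>G\<^esub>"
      using that K K.pow_order_eq_1[of x] by (simp add: order_def flip: T.nat_pow_consistent)
    moreover obtain q where "n = p * q" using p by (auto elim: dvdE)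
    ultimately show "x [^]\<^bsub>G\<^esub> n = \<one>\<^bsub>G\<^esub>" using x by (simp flip: nat_pow_pow)
  qed
  then have "K \<subseteq> {\<one>\<^bsub>G\<^esub>}" by blast
  then have "card K \<le> 1" using card_mono[of "{\<one>\<^bsub>G\<^esub>}" K] by simp
  then show False using K(2) prime_gt_1_nat[OF p(1)] by simp
qed

text \<open>The two torsion orders have product \<open>m * n\<close>. The first is coprime to
  \<open>n\<close>, so it divides \<open>m\<close>; likewise the second divides \<open>n\<close>.
  Two numbers bounded by \<open>m\<close> and \<open>n\<close> with product \<open>m * n\<close>
  must equal these bounds.\<close>

lemma order_torsion:
  assumes "comm_group G" "coprime m n" "m > 0" "n > 0" "order G = m * n"
  shows "order (torsion m G) = m" "order (torsion n G) = n"
proof -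
  interpret comm_group G by fact
  have fin: "finite (carrier G)" using assms order_gt_0_iff_finite by simp
  have "torsion m G \<times>\<times> torsion n G \<cong> G"
    using assms bounded_exponent_order[OF is_group] by (intro iso_torsion_DirProd) auto
  then have eq: "order (torsion m G) * order (torsion n G) = m * n"
    using assms(5) iso_same_card by (fastforce simp: order_def card_cartesian_product)
  moreover have "coprime (order (torsion m G)) n" "coprime (order (torsion n G)) m"
    using assms fin by (simp_all add: coprime_order_torsion coprime_commute[of m n])
  ultimately have d: "order (torsion m G) dvd m" "order (torsion n G) dvd n"
    by (metis coprime_dvd_mult_left_iff dvd_triv_left, metis coprime_dvd_mult_right_iff dvd_triv_right)
  then have "order (torsion m G) \<le> m" "order (torsion n G) \<le> n"
    using assms by (auto intro: dvd_imp_le)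
  moreover have "a = m" "b = n" if "a \<le> m" "b \<le> n" "a * b = m * n" for a b :: nat
  proof -
    have "m * n \<le> a * n" "m * n \<le> m * b"
      using that by (metis mult_le_mono le_refl)+
    then show "a = m" "b = n" using that assms by auto
  qed
  ultimately show "order (torsion m G) = m" "order (torsion n G) = n"
    using eq by blast+
qed

subsection \<open>Direct sums\<close>

text \<open>Over the index set \<open>UNIV\<close> extensionality is vacuous, so the elements are
  just the finitely supported families.\<close>

lemma carrier_sum_group_UNIV:
  assumes "\<And>i. group (g i)"
  shows "carrier (sum_group UNIV g) = {x. (\<forall>i. x i \<in> carrier (g i)) \<and> finite {i. x i \<noteq> \<one>\<^bsub>g i\<^esub>}}"
  using assms by (subst carrier_sum_group) (auto simp: PiE_def)

lemma pow_sum_group_UNIV: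
  fixes k :: nat
  shows "x [^]\<^bsub>sum_group UNIV g\<^esub> k = (\<lambda>i. x i [^]\<^bsub>g i\<^esub> k)"
  by (induction k) (auto simp: restrict_UNIV)

text \<open>Powers are taken componentwise, so a family is \<open>k\<close>-torsion exactly when all
  its components are. Both groups have the same elements, and the identity map is an
  isomorphism.\<close>

lemma torsion_sum_group:
  assumes "\<And>i. comm_group (g i)"
  shows "torsion k (sum_group UNIV g) \<cong> sum_group UNIV (\<lambda>i. torsion k (g i))"
proof -
  have "group (g i)" for i using assms comm_group_def by blast
  note carrier = carrier_sum_group_UNIV[of g, OF this]
    carrier_sum_group_UNIV[of "\<lambda>i. torsion k (g i)", OF group_torsion[OF assms]]
  have "x [^]\<^bsub>sum_group UNIV g\<^esub> k = \<one>\<^bsub>sum_group UNIV g\<^esub> \<longleftrightarrow> (\<forall>i. x i [^]\<^bsub>g i\<^esub> k = \<one>\<^bsub>g i\<^esub>)" for x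
    by (simp add: pow_sum_group_UNIV restrict_UNIV fun_eq_iff)
  then have "carrier (torsion k (sum_group UNIV g)) = carrier (sum_group UNIV (\<lambda>i. torsion k (g i)))"
    unfolding carrier_torsion carrier by auto
  then have "id \<in> iso (torsion k (sum_group UNIV g)) (sum_group UNIV (\<lambda>i. torsion k (g i)))"
    by (simp add: iso_iff hom_def)
  then show ?thesis by (rule is_isoI)
qed

lemma bounded_exponent_sum_group:
  assumes "\<And>i. group (g i)" "bounded_exponent k (sum_group UNIV g)"
  shows "bounded_exponent k (g i)"
  unfolding bounded_exponent_def
proof
  fix x assume x: "x \<in> carrier (g i)"
  \<comment> \<open>\<open>x\<close> placed at index \<open>i\<close> with units elsewhere: the
    image of \<open>x\<close> under the embedding of a summand.\<close>
  define y where "y j = (if j = i then x else \<one>\<^bsub>g j\<^esub>)" for j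
  have "finite {j. y j \<noteq> \<one>\<^bsub>g j\<^esub>}" by (rule finite_subset[of _ "{i}"]) (auto simp: y_def)
  moreover have "y j \<in> carrier (g j)" for j using x assms(1) by (simp add: y_def group.is_monoid)
  ultimately have "y \<in> carrier (sum_group UNIV g)"
    unfolding carrier_sum_group_UNIV[of g, OF assms(1)] by blast
  then have "y [^]\<^bsub>sum_group UNIV g\<^esub> k = \<one>\<^bsub>sum_group UNIV g\<^esub>"
    using assms(2) unfolding bounded_exponent_def by blast
  then have "y i [^]\<^bsub>g i\<^esub> k = \<one>\<^bsub>g i\<^esub>"
    by (simp add: pow_sum_group_UNIV restrict_UNIV fun_eq_iff)
  then show "x [^]\<^bsub>g i\<^esub> k = \<one>\<^bsub>g i\<^esub>" by (simp add: y_def)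
qed

lemma DirProd_sum_group:
  assumes "\<And>i. group (g i)" "\<And>i. group (h i)"
  shows "sum_group UNIV g \<times>\<times> sum_group UNIV h \<cong> sum_group UNIV (\<lambda>i. g i \<times>\<times> h i)"
proof -
  let ?f = "\<lambda>(x, y) i. (x i, y i)"
  let ?A = "sum_group UNIV g \<times>\<times> sum_group UNIV h"
  let ?B = "sum_group UNIV (\<lambda>i. g i \<times>\<times> h i)"
  note carrier = carrier_sum_group_UNIV[of g, OF assms(1)] carrier_sum_group_UNIV[of h, OF assms(2)]
    carrier_sum_group_UNIV[of "\<lambda>i. g i \<times>\<times> h i", OF DirProd_group[OF assms]]
  \<comment> \<open>The support of a family of pairs is the union of the two supports, so pairing
    preserves and reflects finite support.\<close>
  have supp: "{i. (x i, y i) \<noteq> (\<one>\<^bsub>g i\<^esub>, \<one>\<^bsub>h i\<^esub>)} = {i. x i \<noteq> \<one>\<^bsub>g i\<^esub>} \<union> {i. y i \<noteq> \<one>\<^bsub>h i\<^esub>}" for x y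
    by auto
  have mem: "?f (x, y) \<in> carrier ?B \<longleftrightarrow> (x, y) \<in> carrier ?A" for x y
    unfolding carrier carrier_DirProd mem_Collect_eq mem_Times_iff prod.case one_DirProd fst_conv snd_conv supp
    by blast
  have "?f \<in> hom ?A ?B"
  proof (rule homI)
    fix p q
    show "p \<in> carrier ?A \<Longrightarrow> ?f p \<in> carrier ?B" using mem by (cases p) blast
    show "?f (p \<otimes>\<^bsub>?A\<^esub> q) = ?f p \<otimes>\<^bsub>?B\<^esub> ?f q" by (cases p; cases q) (simp add: restrict_UNIV)
  qed
  moreover have "inj_on ?f (carrier ?A)"
    by (auto simp: inj_on_def fun_eq_iff)
  moreover have "carrier ?B \<subseteq> ?f ` carrier ?A"
  proof
    fix z assume z: "z \<in> carrier ?B"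
    have eq: "z = ?f (fst \<circ> z, snd \<circ> z)" by auto
    have "?f (fst \<circ> z, snd \<circ> z) \<in> carrier ?B" by (subst eq[symmetric]) (rule z)
    then have "(fst \<circ> z, snd \<circ> z) \<in> carrier ?A" by (simp only: mem)
    with eq show "z \<in> ?f ` carrier ?A" by (rule image_eqI)
  qed
  ultimately have "?f \<in> iso ?A ?B"
    by (simp add: iso_iff_mon_epi epi_iff_subset mon_def)
  then show ?thesis by (rule is_isoI)
qed

subsection \<open>Isomorphism classes\<close>

definition finite_abelian :: "('a, 'b) monoid_scheme \<Rightarrow> bool" where
  "finite_abelian G \<longleftrightarrow> comm_group G \<and> finite (carrier G)"

text \<open>The argument may have any carrier type while the members live on \<open>nat\<close>;
  this gives a class to products, whose elements are pairs.\<close>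

definition iso_class_of :: "('a, 'b) monoid_scheme \<Rightarrow> iso_class" where
  "iso_class_of G = {H. finite_abelian H \<and> G \<cong> H}"

lemma finite_abelian_group: "finite_abelian G \<Longrightarrow> group G"
  by (simp add: finite_abelian_def comm_group_def)

lemma finite_abelian_torsion: "finite_abelian G \<Longrightarrow> finite_abelian (torsion k G)"
  by (simp add: finite_abelian_def comm_group_torsion carrier_torsion)

lemma finite_abelian_DirProd:
  assumes "finite_abelian G" "finite_abelian H"
  shows "finite_abelian (G \<times>\<times> H)"
proof -
  interpret G: comm_group G using assms by (simp add: finite_abelian_def)
  interpret H: comm_group H using assms by (simp add: finite_abelian_def)
  have "comm_group (G \<times>\<times> H)"
    by (rule group.group_comm_groupI[OF DirProd_group])
       (auto simp: G.is_group H.is_group G.m_comm H.m_comm)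
  then show ?thesis using assms by (simp add: finite_abelian_def)
qed

lemma finite_abelian_iso_nat:
  assumes "finite_abelian G"
  obtains H :: "nat monoid" where "finite_abelian H" "G \<cong> H"
  using finite_abelian_group_representable[of G] assms
  by (auto simp: finite_abelian_def finite_abelian_groups_def)

lemma iso_class_of_eqI:
  assumes "finite_abelian G" "finite_abelian H" "G \<cong> H"
  shows "iso_class_of G = iso_class_of H"
proof -
  have "H \<cong> G" using assms by (simp add: finite_abelian_group group.iso_sym)
  then show ?thesis
    using assms(3) by (auto simp: iso_class_of_def intro: iso_trans)
qed

text \<open>Equal classes give isomorphic groups because the classes are nonempty: a common member
  \<open>K\<close> on \<open>nat\<close> links \<open>G\<close> to \<open>H\<close>.\<close>

lemma iso_class_of_eq_iff:
  assumes "finite_abelian G" "finite_abelian H"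
  shows "iso_class_of G = iso_class_of H \<longleftrightarrow> G \<cong> H"
proof
  assume eq: "iso_class_of G = iso_class_of H"
  obtain K :: "nat monoid" where "finite_abelian K" "H \<cong> K"
    using assms finite_abelian_iso_nat by blast
  with eq have "G \<cong> K" "K \<cong> H"
    using assms by (auto simp: iso_class_of_def finite_abelian_group intro: group.iso_sym)
  then show "G \<cong> H" by (rule iso_trans)
qed (simp add: iso_class_of_eqI assms)

lemma iso_class_of_nat: "finite_abelian G \<Longrightarrow> iso_class_of G = group_iso_rel `` {G}"
  by (auto simp: iso_class_of_def group_iso_rel_def finite_abelian_groups_def finite_abelian_def)

lemma iso_class_of_in_iso_classes:
  assumes "finite_abelian G"
  shows "iso_class_of G \<in> iso_classes"
proof -
  obtain H :: "nat monoid" where H: "finite_abelian H" "G \<cong> H"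
    using assms finite_abelian_iso_nat by blast
  then have "iso_class_of G = group_iso_rel `` {H}"
    using assms iso_class_of_eqI iso_class_of_nat by blast
  moreover have "H \<in> finite_abelian_groups"
    using H by (simp add: finite_abelian_groups_def finite_abelian_def)
  ultimately show ?thesis by (simp add: iso_classes_def quotientI)
qed

lemma iso_classesE:
  assumes "C \<in> iso_classes"
  obtains G :: "nat monoid" where "finite_abelian G" "C = iso_class_of G"
proof -
  obtain G where "G \<in> finite_abelian_groups" "C = group_iso_rel `` {G}"
    using assms by (auto simp: iso_classes_def elim: quotientE)
  then show ?thesis
    using that[of G] by (simp add: iso_class_of_nat finite_abelian_groups_def finite_abelian_def)
qed

lemma iso_class_ofE:
  assumes "finite_abelian G"
  obtains H where "H \<in> iso_class_of G" "finite_abelian H" "G \<cong> H" "H \<cong> G"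
proof -
  obtain H :: "nat monoid" where "finite_abelian H" "G \<cong> H"
    using assms finite_abelian_iso_nat by blast
  then show ?thesis
    using that[of H] group.iso_sym[OF finite_abelian_group] assms by (auto simp: iso_class_of_def)
qed

text \<open>This and the following equivalences evaluate a notion on classes at any given group,
  which works because the notion is invariant under isomorphism.\<close>

lemma class_has_order_iff:
  assumes "finite_abelian G"
  shows "class_has_order (iso_class_of G) n \<longleftrightarrow> order G = n"
proof -
  obtain H where "H \<in> iso_class_of G" using assms iso_class_ofE by blast
  moreover have "order K = order G" if "K \<in> iso_class_of G" for K
    using that iso_same_card by (fastforce simp: iso_class_of_def order_def)
  ultimately show ?thesis by (auto simp: class_has_order_def)
qed

lemma class_trivial_iff:
  assumes "finite_abelian G"
  shows "class_trivial (iso_class_of G) \<longleftrightarrow> trivial_group G"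
proof -
  obtain H where "H \<in> iso_class_of G" using assms iso_class_ofE by blast
  moreover have "trivial_group K \<longleftrightarrow> trivial_group G" if "K \<in> iso_class_of G" for K
    using that assms isomorphic_group_triviality[of G K]
    by (simp add: iso_class_of_def finite_abelian_group)
  ultimately show ?thesis by (auto simp: class_trivial_def)
qed

lemma mon_iso_cong:
  assumes "G \<cong> G'" "H' \<cong> H" "mon H G \<noteq> {}"
  shows "mon H' G' \<noteq> {}"
proof -
  obtain f g h where "f \<in> mon H' H" "g \<in> mon H G" "h \<in> mon G G'"
    using assms by (auto simp: is_iso_def iso_iff_mon_epi)
  then have "h \<circ> (g \<circ> f) \<in> mon H' G'" by (intro mon_compose)
  then show ?thesis by blast
qed

text \<open>A subgroup isomorphic to \<open>H\<close> is the image of an injective homomorphism from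
  \<open>H\<close>. Monomorphisms, unlike subgroups up to isomorphism, restrict to torsion and pair
  up in products directly.\<close>

lemma class_contains_iff:
  assumes "finite_abelian G" "finite_abelian H"
  shows "class_contains (iso_class_of G) (iso_class_of H) \<longleftrightarrow> mon H G \<noteq> {}"
proof
  assume "class_contains (iso_class_of G) (iso_class_of H)"
  then obtain G' H' :: "nat monoid" and K
    where *: "finite_abelian G'" "G \<cong> G'" "H \<cong> H'" "subgroup K G'" "H' \<cong> G'\<lparr>carrier := K\<rparr>"
    by (auto simp: class_contains_def iso_class_of_def)
  have "id \<in> mon (G'\<lparr>carrier := K\<rparr>) G'"
    using subgroup.subset[OF *(4)] by (auto simp: mon_def hom_def)
  then have "mon (G'\<lparr>carrier := K\<rparr>) G' \<noteq> {}" by blast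
  moreover have "H \<cong> G'\<lparr>carrier := K\<rparr>" using * iso_trans by blast
  moreover have "G' \<cong> G" using * assms group.iso_sym finite_abelian_group by blast
  ultimately show "mon H G \<noteq> {}" using mon_iso_cong by blast
next
  assume mon: "mon H G \<noteq> {}"
  obtain G' where G': "G' \<in> iso_class_of G" "finite_abelian G'" "G \<cong> G'"
    using assms iso_class_ofE by blast
  obtain H' where H': "H' \<in> iso_class_of H" "finite_abelian H'" "H' \<cong> H"
    using assms iso_class_ofE by blast
  obtain f where f: "f \<in> mon H' G'"
    using mon_iso_cong[OF G'(3) H'(3) mon] by blast
  then interpret group_hom H' G' f
    using G' H' by (simp add: group_hom_def group_hom_axioms_def finite_abelian_group mon_def)
  have "f \<in> iso H' (G'\<lparr>carrier := f ` carrier H'\<rparr>)"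
    using f by (auto simp: mon_def Group.iso_iff hom_def)
  then show "class_contains (iso_class_of G) (iso_class_of H)"
    using G' H' img_is_subgroup is_isoI unfolding class_contains_def by blast
qed

lemma class_is_direct_sum_iff:
  assumes "finite_abelian G" "\<And>i. finite_abelian (g i)"
  shows "class_is_direct_sum (iso_class_of G) (\<lambda>i. iso_class_of (g i)) \<longleftrightarrow> G \<cong> sum_group UNIV g"
proof
  assume "class_is_direct_sum (iso_class_of G) (\<lambda>i. iso_class_of (g i))"
  then obtain G' h where "G' \<in> iso_class_of G" "\<forall>i. h i \<in> iso_class_of (g i)"
      and sum: "G' \<cong> sum_group UNIV h"
    unfolding class_is_direct_sum_def by blast
  then have *: "G \<cong> G'" "\<And>i. finite_abelian (h i)" "\<And>i. g i \<cong> h i"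
    by (auto simp: iso_class_of_def)
  have "h i \<cong> g i" for i
    using group.iso_sym[OF finite_abelian_group] assms(2) *(3) by blast
  then have "sum_group UNIV h \<cong> sum_group UNIV g"
    by (rule iso_sum_groupI) (rule finite_abelian_group assms(2) *(2))+
  then show "G \<cong> sum_group UNIV g" by (rule iso_trans[OF iso_trans[OF *(1) sum]])
next
  assume G: "G \<cong> sum_group UNIV g"
  obtain G' where G': "G' \<in> iso_class_of G" "G' \<cong> G"
    by (rule iso_class_ofE[OF assms(1)])
  \<comment> \<open>A member on \<open>nat\<close> is chosen for every index at once, since the
    class-level direct sum asks for a whole family.\<close>
  have "\<exists>H. H \<in> iso_class_of (g i) \<and> finite_abelian H \<and> g i \<cong> H" for i
    by (rule iso_class_ofE[OF assms(2)[of i]]) blast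
  then have "\<exists>h. \<forall>i. h i \<in> iso_class_of (g i) \<and> finite_abelian (h i) \<and> g i \<cong> h i"
    by (intro choice allI)
  then obtain h where h: "\<And>i. h i \<in> iso_class_of (g i)" "\<And>i. finite_abelian (h i)" "\<And>i. g i \<cong> h i"
    by blast
  have "sum_group UNIV g \<cong> sum_group UNIV h"
    by (rule iso_sum_groupI) (rule h(3) finite_abelian_group assms(2) h(2))+
  then have "G' \<cong> sum_group UNIV h" by (rule iso_trans[OF iso_trans[OF G'(2) G]])
  then show "class_is_direct_sum (iso_class_of G) (\<lambda>i. iso_class_of (g i))"
    unfolding class_is_direct_sum_def using G'(1) h(1) by blast
qed

lemma group_partition_iff:
  assumes "finite_abelian G" "\<And>i. finite_abelian (g i)"
  shows "group_partition (iso_class_of G) (\<lambda>i. iso_class_of (g i)) \<longleftrightarrow>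
    finite {i. \<not> trivial_group (g i)} \<and> G \<cong> sum_group UNIV g \<and> (\<forall>i. mon (g (Suc i)) (g i) \<noteq> {})"
  unfolding group_partition_def class_trivial_iff[OF assms(2)] class_is_direct_sum_iff[OF assms]
    class_contains_iff[OF assms(2) assms(2)]
  by (simp only: iso_class_of_in_iso_classes[OF assms(2)] simp_thms)

section \<open>Torsion, products and exponents of classes\<close>

definition class_torsion :: "nat \<Rightarrow> iso_class \<Rightarrow> iso_class" where
  "class_torsion k C = iso_class_of (torsion k (SOME G. G \<in> C))"

definition class_prod :: "iso_class \<Rightarrow> iso_class \<Rightarrow> iso_class" where
  "class_prod C D = iso_class_of ((SOME G. G \<in> C) \<times>\<times> (SOME H. H \<in> D))"

definition class_bounded_exponent :: "nat \<Rightarrow> iso_class \<Rightarrow> bool" where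
  "class_bounded_exponent k C \<longleftrightarrow> (\<exists>G\<in>C. bounded_exponent k G)"

lemma some_iso_class_of:
  assumes "finite_abelian G"
  shows "finite_abelian (SOME H. H \<in> iso_class_of G)" "G \<cong> (SOME H. H \<in> iso_class_of G)"
proof -
  have "\<exists>H. H \<in> iso_class_of G"
    by (rule iso_class_ofE[OF assms]) blast
  then have "(SOME H. H \<in> iso_class_of G) \<in> iso_class_of G" by (rule someI_ex)
  then show "finite_abelian (SOME H. H \<in> iso_class_of G)" "G \<cong> (SOME H. H \<in> iso_class_of G)"
    by (simp_all add: iso_class_of_def)
qed

text \<open>Isomorphic groups have isomorphic torsion, so the representative picked by
  \<open>SOME\<close> does not matter.\<close>

lemma class_torsion_iso_class_of:
  assumes "finite_abelian G"
  shows "class_torsion k (iso_class_of G) = iso_class_of (torsion k G)"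
  unfolding class_torsion_def using some_iso_class_of[OF assms] assms
  by (intro iso_class_of_eqI[symmetric] finite_abelian_torsion iso_torsion finite_abelian_group)

lemma class_prod_iso_class_of:
  assumes "finite_abelian G" "finite_abelian H"
  shows "class_prod (iso_class_of G) (iso_class_of H) = iso_class_of (G \<times>\<times> H)"
  unfolding class_prod_def using some_iso_class_of[OF assms(1)] some_iso_class_of[OF assms(2)] assms
  by (intro iso_class_of_eqI[symmetric] finite_abelian_DirProd DirProd_iso finite_abelian_group)

lemma bounded_exponent_iso:
  assumes "G \<cong> H" "group G" "group H" "bounded_exponent k H"
  shows "bounded_exponent k G"
proof -
  obtain f where "f \<in> mon G H" using assms(1) by (auto simp: is_iso_def iso_iff_mon_epi)
  then show ?thesis by (rule bounded_exponent_mon[OF _ assms(2-4)])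
qed

lemma class_bounded_exponent_iff:
  assumes "finite_abelian G"
  shows "class_bounded_exponent k (iso_class_of G) \<longleftrightarrow> bounded_exponent k G"
proof
  assume "class_bounded_exponent k (iso_class_of G)"
  then obtain H :: "nat monoid" where H: "finite_abelian H" "G \<cong> H" "bounded_exponent k H"
    by (auto simp: class_bounded_exponent_def iso_class_of_def)
  show "bounded_exponent k G"
    by (rule bounded_exponent_iso[OF H(2) finite_abelian_group[OF assms] finite_abelian_group[OF H(1)] H(3)])
next
  assume G: "bounded_exponent k G"
  obtain H where H: "H \<in> iso_class_of G" "finite_abelian H" "H \<cong> G"
    by (rule iso_class_ofE[OF assms])
  have "bounded_exponent k H"
    by (rule bounded_exponent_iso[OF H(3) finite_abelian_group[OF H(2)] finite_abelian_group[OF assms] G])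
  then show "class_bounded_exponent k (iso_class_of G)"
    using H(1) by (auto simp: class_bounded_exponent_def)
qed

lemma class_torsion_in_iso_classes: "C \<in> iso_classes \<Longrightarrow> class_torsion k C \<in> iso_classes"
  by (auto elim!: iso_classesE simp: class_torsion_iso_class_of finite_abelian_torsion
      iso_class_of_in_iso_classes)

lemma class_prod_in_iso_classes:
  "C \<in> iso_classes \<Longrightarrow> D \<in> iso_classes \<Longrightarrow> class_prod C D \<in> iso_classes"
  by (auto elim!: iso_classesE simp: class_prod_iso_class_of finite_abelian_DirProd
      iso_class_of_in_iso_classes)

lemma class_bounded_exponent_order:
  assumes "C \<in> iso_classes" "class_has_order C n"
  shows "class_bounded_exponent n C"
proof -
  obtain G :: "nat monoid" where G: "finite_abelian G" "C = iso_class_of G"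
    using assms iso_classesE by blast
  then show ?thesis
    using bounded_exponent_order[OF finite_abelian_group[OF G(1)]] assms(2)
    by (simp add: class_has_order_iff class_bounded_exponent_iff)
qed

text \<open>With \<open>class_torsion_prod\<close>, this makes splitting and multiplying mutually
  inverse. The pair is used twice: on the group being partitioned and on each factor of a
  partition.\<close>

lemma class_prod_torsion:
  assumes "C \<in> iso_classes" "class_bounded_exponent (m * n) C" "coprime m n" "m > 0"
  shows "class_prod (class_torsion m C) (class_torsion n C) = C"
proof -
  obtain G :: "nat monoid" where G: "finite_abelian G" "C = iso_class_of G"
    using assms iso_classesE by blast
  have "torsion m G \<times>\<times> torsion n G \<cong> G"
    using assms G by (intro iso_torsion_DirProd) (simp_all add: class_bounded_exponent_iff finite_abelian_def)
  then show ?thesis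
    using G by (simp add: class_torsion_iso_class_of class_prod_iso_class_of finite_abelian_torsion
        iso_class_of_eq_iff finite_abelian_DirProd)
qed

lemma class_torsion_prod:
  assumes "C \<in> iso_classes" "D \<in> iso_classes" "class_bounded_exponent m C" "class_bounded_exponent n D"
    and "coprime m n" "m > 0" "n > 0"
  shows "class_torsion m (class_prod C D) = C" "class_torsion n (class_prod C D) = D"
proof -
  obtain G :: "nat monoid" where G: "finite_abelian G" "C = iso_class_of G"
    using assms iso_classesE by blast
  obtain H :: "nat monoid" where H: "finite_abelian H" "D = iso_class_of H"
    using assms iso_classesE by blast
  have exp: "bounded_exponent m G" "bounded_exponent n H"
    using assms G H by (simp_all add: class_bounded_exponent_iff)
  note grp = finite_abelian_group[OF G(1)] finite_abelian_group[OF H(1)]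
  have "torsion m (G \<times>\<times> H) \<cong> G" "torsion n (G \<times>\<times> H) \<cong> H"
    by (rule torsion_DirProd_left[OF grp assms(5,6) exp] torsion_DirProd_right[OF grp assms(5,7) exp])+
  then show "class_torsion m (class_prod C D) = C" "class_torsion n (class_prod C D) = D"
    using G H by (simp_all add: class_torsion_iso_class_of class_prod_iso_class_of
        finite_abelian_DirProd iso_class_of_eq_iff finite_abelian_torsion)
qed

lemma class_trivial_prod:
  assumes "C \<in> iso_classes" "D \<in> iso_classes"
  shows "class_trivial (class_prod C D) \<longleftrightarrow> class_trivial C \<and> class_trivial D"
proof -
  obtain G :: "nat monoid" where G: "finite_abelian G" "C = iso_class_of G"
    using assms iso_classesE by blast
  obtain H :: "nat monoid" where H: "finite_abelian H" "D = iso_class_of H"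
    using assms iso_classesE by blast
  interpret G: group G by (rule finite_abelian_group[OF G(1)])
  interpret H: group H by (rule finite_abelian_group[OF H(1)])
  have "trivial_group (G \<times>\<times> H) \<longleftrightarrow> trivial_group G \<and> trivial_group H"
    unfolding trivial_group_def using DirProd_group[OF G.is_group H.is_group] G.is_group H.is_group
    by (auto simp: set_eq_iff)
  then show ?thesis
    using G H by (simp add: class_prod_iso_class_of class_trivial_iff finite_abelian_DirProd)
qed

lemma class_trivial_torsion:
  assumes "C \<in> iso_classes" "class_trivial C"
  shows "class_trivial (class_torsion k C)"
proof -
  obtain G :: "nat monoid" where G: "finite_abelian G" "C = iso_class_of G"
    using assms iso_classesE by blast
  then have "trivial_group G" using assms by (simp add: class_trivial_iff)
  then have "trivial_group (torsion k G)"
    using G group.trivial_group_subset[OF finite_abelian_group[OF finite_abelian_torsion[OF G(1)]]]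
    by (auto simp: trivial_group_def carrier_torsion)
  then show ?thesis
    using G by (simp add: class_torsion_iso_class_of class_trivial_iff finite_abelian_torsion)
qed

lemma class_has_order_prod:
  assumes "C \<in> iso_classes" "D \<in> iso_classes" "class_has_order C m" "class_has_order D n"
  shows "class_has_order (class_prod C D) (m * n)"
  using assms
  by (auto elim!: iso_classesE simp: class_prod_iso_class_of class_has_order_iff
      finite_abelian_DirProd order_def card_cartesian_product)

lemma class_has_order_torsion:
  assumes "C \<in> iso_classes" "class_has_order C (m * n)" "coprime m n" "m > 0" "n > 0"
  shows "class_has_order (class_torsion m C) m" "class_has_order (class_torsion n C) n"
proof -
  obtain G :: "nat monoid" where G: "finite_abelian G" "C = iso_class_of G"
    using assms iso_classesE by blast
  have "comm_group G" "order G = m * n"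
    using G assms by (simp_all add: class_has_order_iff finite_abelian_def)
  then have "order (torsion m G) = m" "order (torsion n G) = n"
    using order_torsion assms by blast+
  then show "class_has_order (class_torsion m C) m" "class_has_order (class_torsion n C) n"
    using G by (simp_all add: class_torsion_iso_class_of class_has_order_iff finite_abelian_torsion)
qed

subsection \<open>Group-partitions\<close>

lemma group_partition_in_iso_classes: "group_partition C P \<Longrightarrow> P i \<in> iso_classes"
  by (simp add: group_partition_def)

lemma group_partitionE:
  assumes "C \<in> iso_classes" "group_partition C P"
  obtains G :: "nat monoid" and g :: "nat \<Rightarrow> nat monoid"
  where "finite_abelian G" "C = iso_class_of G" "\<And>i. finite_abelian (g i)" "P = (\<lambda>i. iso_class_of (g i))"
    "finite {i. \<not> trivial_group (g i)}" "G \<cong> sum_group UNIV g" "\<And>i. mon (g (Suc i)) (g i) \<noteq> {}"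
proof -
  obtain G :: "nat monoid" where G: "finite_abelian G" "C = iso_class_of G"
    using assms iso_classesE by blast
  have "\<exists>H :: nat monoid. finite_abelian H \<and> P i = iso_class_of H" for i
    by (rule iso_classesE[OF group_partition_in_iso_classes[OF assms(2), of i]]) blast
  then have "\<exists>g :: nat \<Rightarrow> nat monoid. \<forall>i. finite_abelian (g i) \<and> P i = iso_class_of (g i)"
    by (intro choice allI)
  then obtain g :: "nat \<Rightarrow> nat monoid"
    where g: "\<And>i. finite_abelian (g i)" "\<And>i. P i = iso_class_of (g i)"
    by blast
  have P: "P = (\<lambda>i. iso_class_of (g i))" using g(2) by (rule ext)
  have "group_partition (iso_class_of G) (\<lambda>i. iso_class_of (g i))"
    using assms(2) unfolding P G(2) .
  then show ?thesis
    using that[OF G g(1) P] unfolding group_partition_iff[OF G(1) g(1)] by blast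
qed

text \<open>Each factor embeds in the direct sum and so inherits the exponent bound of the whole
  group. This makes the coprime splitting applicable factor by factor.\<close>

lemma group_partition_bounded_exponent:
  assumes "C \<in> iso_classes" "group_partition C P" "class_bounded_exponent k C"
  shows "class_bounded_exponent k (P i)"
proof (rule group_partitionE[OF assms(1,2)])
  fix G :: "nat monoid" and g :: "nat \<Rightarrow> nat monoid"
  assume G: "finite_abelian G" "C = iso_class_of G"
    and g: "\<And>i. finite_abelian (g i)" "P = (\<lambda>i. iso_class_of (g i))" "G \<cong> sum_group UNIV g"
  have grp: "group (g i)" for i by (rule finite_abelian_group[OF g(1)])
  then have "group (sum_group UNIV g)" by simp
  moreover have "sum_group UNIV g \<cong> G"
    using G g(3) group.iso_sym finite_abelian_group by blast
  ultimately have "bounded_exponent k (sum_group UNIV g)"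
    using assms(3) G by (simp add: bounded_exponent_iso class_bounded_exponent_iff finite_abelian_group)
  then have "bounded_exponent k (g i)" by (rule bounded_exponent_sum_group[OF grp])
  then show ?thesis using g by (simp add: class_bounded_exponent_iff)
qed

text \<open>Each condition survives: torsion commutes with direct sums, restricts monomorphisms, and
  keeps trivial groups trivial.\<close>

lemma group_partition_torsion:
  assumes "C \<in> iso_classes" "group_partition C P"
  shows "group_partition (class_torsion k C) (\<lambda>i. class_torsion k (P i))"
proof (rule group_partitionE[OF assms])
  fix G :: "nat monoid" and g :: "nat \<Rightarrow> nat monoid"
  assume G: "finite_abelian G" "C = iso_class_of G"
    and g: "\<And>i. finite_abelian (g i)" "P = (\<lambda>i. iso_class_of (g i))"
    and fin: "finite {i. \<not> trivial_group (g i)}" and sum: "G \<cong> sum_group UNIV g"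
    and mon: "\<And>i. mon (g (Suc i)) (g i) \<noteq> {}"
  have comm: "comm_group (g i)" and grp: "group (g i)" for i
    using g(1) by (simp_all add: finite_abelian_def finite_abelian_group)
  have "trivial_group (torsion k (g i))" if "trivial_group (g i)" for i
    using that class_trivial_torsion[OF iso_class_of_in_iso_classes[OF g(1)[of i]], of k] g(1)
    by (simp add: class_torsion_iso_class_of class_trivial_iff finite_abelian_torsion)
  then have "finite {i. \<not> trivial_group (torsion k (g i))}"
    by (intro finite_subset[OF _ fin]) blast
  moreover have "torsion k G \<cong> sum_group UNIV (\<lambda>i. torsion k (g i))"
    by (rule iso_trans[OF iso_torsion[OF sum] torsion_sum_group])
       (simp_all add: finite_abelian_group G comm grp)
  moreover have "mon (torsion k (g (Suc i))) (torsion k (g i)) \<noteq> {}" for i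
    using mon[of i] mon_torsion[OF _ grp grp, of _ "Suc i" i] by blast
  ultimately have "group_partition (iso_class_of (torsion k G)) (\<lambda>i. iso_class_of (torsion k (g i)))"
    unfolding group_partition_iff[OF finite_abelian_torsion[OF G(1)] finite_abelian_torsion[OF g(1)]]
    by blast
  then show ?thesis
    unfolding G(2) g(2) class_torsion_iso_class_of[OF G(1)] class_torsion_iso_class_of[OF g(1)] .
qed

text \<open>Products of monomorphisms are monomorphisms, products of direct sums are direct sums of
  products, and a product is nontrivial only where one of its factors is.\<close>

lemma group_partition_prod:
  assumes "C \<in> iso_classes" "group_partition C P" "D \<in> iso_classes" "group_partition D Q"
  shows "group_partition (class_prod C D) (\<lambda>i. class_prod (P i) (Q i))"
proof (rule group_partitionE[OF assms(1,2)], rule group_partitionE[OF assms(3,4)])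
  fix G H :: "nat monoid" and g h :: "nat \<Rightarrow> nat monoid"
  assume G: "finite_abelian G" "C = iso_class_of G"
    and g: "\<And>i. finite_abelian (g i)" "P = (\<lambda>i. iso_class_of (g i))"
    and fing: "finite {i. \<not> trivial_group (g i)}" and sumg: "G \<cong> sum_group UNIV g"
    and mong: "\<And>i. mon (g (Suc i)) (g i) \<noteq> {}"
  assume H: "finite_abelian H" "D = iso_class_of H"
    and h: "\<And>i. finite_abelian (h i)" "Q = (\<lambda>i. iso_class_of (h i))"
    and finh: "finite {i. \<not> trivial_group (h i)}" and sumh: "H \<cong> sum_group UNIV h"
    and monh: "\<And>i. mon (h (Suc i)) (h i) \<noteq> {}"
  have triv: "trivial_group (g i \<times>\<times> h i)" if "trivial_group (g i)" "trivial_group (h i)" for i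
    using that unfolding trivial_group_def by (simp add: DirProd_group)
  have "finite {i. \<not> trivial_group (g i \<times>\<times> h i)}"
    by (rule finite_subset[OF _ finite_UnI[OF fing finh]]) (use triv in blast)
  moreover have "G \<times>\<times> H \<cong> sum_group UNIV (\<lambda>i. g i \<times>\<times> h i)"
    by (rule iso_trans[OF DirProd_iso[OF sumg sumh] DirProd_sum_group])
       (rule finite_abelian_group G(1) H(1) g(1) h(1))+
  moreover have "mon (g (Suc i) \<times>\<times> h (Suc i)) (g i \<times>\<times> h i) \<noteq> {}" for i
    using mong[of i] monh[of i] DirProd_mon by blast
  ultimately have "group_partition (iso_class_of (G \<times>\<times> H)) (\<lambda>i. iso_class_of (g i \<times>\<times> h i))"
    unfolding group_partition_iff[OF finite_abelian_DirProd[OF G(1) H(1)] finite_abelian_DirProd[OF g(1) h(1)]]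
    by blast
  then show ?thesis
    unfolding G(2) g(2) H(2) h(2) class_prod_iso_class_of[OF G(1) H(1)]
      class_prod_iso_class_of[OF g(1) h(1)] .
qed

text \<open>A group that embeds in a trivial group is trivial, and this propagates by induction
  along the chain. Hence the indices of nontrivial factors form an initial segment.\<close>

lemma group_partition_trivial_mono:
  assumes "C \<in> iso_classes" "group_partition C P" "class_trivial (P i)" "i \<le> j"
  shows "class_trivial (P j)"
proof (rule group_partitionE[OF assms(1,2)])
  fix g :: "nat \<Rightarrow> nat monoid"
  assume g: "\<And>i. finite_abelian (g i)" "P = (\<lambda>i. iso_class_of (g i))"
    and mon: "\<And>i. mon (g (Suc i)) (g i) \<noteq> {}"
  have "trivial_group (g j)" using \<open>i \<le> j\<close>
  proof (induction j rule: dec_induct)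
    case base
    then show ?case using assms(3) g by (simp add: class_trivial_iff)
  next
    case (step j)
    interpret group "g (Suc j)" by (rule finite_abelian_group[OF g(1)])
    obtain f where f: "f \<in> hom (g (Suc j)) (g j)" "inj_on f (carrier (g (Suc j)))"
      using mon[of j] by (auto simp: mon_def)
    have "x = \<one>\<^bsub>g (Suc j)\<^esub>" if "x \<in> carrier (g (Suc j))" for x
    proof (rule inj_onD[OF f(2)])
      show "f x = f \<one>\<^bsub>g (Suc j)\<^esub>"
        using hom_in_carrier[OF f(1) that] hom_in_carrier[OF f(1) one_closed] step.IH
        by (simp add: trivial_group_def)
    qed (use that in auto)
    then show ?case by (simp add: trivial_group_subset subset_iff)
  qed
  then show ?thesis using g by (simp add: class_trivial_iff)
qed

lemma downward_closed_nat_linear: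
  fixes A B :: "nat set"
  assumes "\<And>i j. j \<in> A \<Longrightarrow> i \<le> j \<Longrightarrow> i \<in> A" "\<And>i j. j \<in> B \<Longrightarrow> i \<le> j \<Longrightarrow> i \<in> B"
  shows "A \<subseteq> B \<or> B \<subseteq> A"
proof (rule ccontr)
  assume "\<not> ?thesis"
  then obtain a b where "a \<in> A" "a \<notin> B" "b \<in> B" "b \<notin> A" by blast
  then show False using assms nat_le_linear[of a b] by blast
qed

section \<open>The bijection for partitions with at most \<open>r\<close> nontrivial factors\<close>

definition bounded_group_partitions :: "enat \<Rightarrow> iso_class \<Rightarrow> (nat \<Rightarrow> iso_class) set" where
  "bounded_group_partitions r C =
     {P. group_partition C P \<and> enat (card {i. \<not> class_trivial (P i)}) \<le> r}"

lemma bounded_group_partitions_torsion: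
  assumes C: "C \<in> iso_classes" and P: "P \<in> bounded_group_partitions r C"
  shows "(\<lambda>i. class_torsion k (P i)) \<in> bounded_group_partitions r (class_torsion k C)"
proof -
  have part: "group_partition C P" and r: "enat (card {i. \<not> class_trivial (P i)}) \<le> r"
    using P by (simp_all add: bounded_group_partitions_def)
  \<comment> \<open>Finiteness is essential for comparing the counts, since \<open>card\<close> is 0
    on infinite sets.\<close>
  have "finite {i. \<not> class_trivial (P i)}" using part by (simp add: group_partition_def)
  moreover have "{i. \<not> class_trivial (class_torsion k (P i))} \<subseteq> {i. \<not> class_trivial (P i)}"
    using class_trivial_torsion[OF group_partition_in_iso_classes[OF part]] by blast
  ultimately have "card {i. \<not> class_trivial (class_torsion k (P i))} \<le> card {i. \<not> class_trivial (P i)}"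
    by (rule card_mono)
  then have "enat (card {i. \<not> class_trivial (class_torsion k (P i))}) \<le> r"
    using r by (meson enat_ord_simps(1) order_trans)
  then show ?thesis
    using group_partition_torsion[OF C part] by (simp add: bounded_group_partitions_def)
qed

text \<open>A product factor is nontrivial where either factor is, so the index set is a union. Both
  sets are initial segments, so the union is the larger one, and the bound stays \<open>r\<close>
  instead of growing to twice \<open>r\<close>.\<close>

lemma bounded_group_partitions_prod:
  assumes C: "C \<in> iso_classes" and D: "D \<in> iso_classes"
    and P: "P \<in> bounded_group_partitions r C" and Q: "Q \<in> bounded_group_partitions r D"
  shows "(\<lambda>i. class_prod (P i) (Q i)) \<in> bounded_group_partitions r (class_prod C D)"
proof -
  have partP: "group_partition C P" and rP: "enat (card {i. \<not> class_trivial (P i)}) \<le> r"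
    using P by (simp_all add: bounded_group_partitions_def)
  have partQ: "group_partition D Q" and rQ: "enat (card {i. \<not> class_trivial (Q i)}) \<le> r"
    using Q by (simp_all add: bounded_group_partitions_def)
  let ?A = "{i. \<not> class_trivial (P i)}" and ?B = "{i. \<not> class_trivial (Q i)}"
  have "{i. \<not> class_trivial (class_prod (P i) (Q i))} = ?A \<union> ?B"
    using class_trivial_prod[OF group_partition_in_iso_classes[OF partP] group_partition_in_iso_classes[OF partQ]]
    by blast
  moreover have "?A \<subseteq> ?B \<or> ?B \<subseteq> ?A"
    by (rule downward_closed_nat_linear)
       (use group_partition_trivial_mono[OF C partP] group_partition_trivial_mono[OF D partQ] in blast)+
  then have "?A \<union> ?B = ?A \<or> ?A \<union> ?B = ?B" by blast
  ultimately have "enat (card {i. \<not> class_trivial (class_prod (P i) (Q i))}) \<le> r"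
    using rP rQ by (elim disjE) simp_all
  then show ?thesis
    using group_partition_prod[OF C partP D partQ] by (simp add: bounded_group_partitions_def)
qed

lemma num_group_partitions_prod:
  assumes C: "C \<in> iso_classes" "class_bounded_exponent m C"
    and D: "D \<in> iso_classes" "class_bounded_exponent n D"
    and mn: "coprime m n" "m > 0" "n > 0"
    and exp: "class_bounded_exponent (m * n) (class_prod C D)"
  shows "num_group_partitions r (class_prod C D) = num_group_partitions r C * num_group_partitions r D"
proof -
  let ?E = "class_prod C D"
  have E: "?E \<in> iso_classes" by (rule class_prod_in_iso_classes[OF C(1) D(1)])
  \<comment> \<open>Identifies the groups partitioned by the two components of \<open>?f\<close> as
    \<open>C\<close> and \<open>D\<close>.\<close>
  have tor: "class_torsion m ?E = C" "class_torsion n ?E = D"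
    by (rule class_torsion_prod[OF C(1) D(1) C(2) D(2) mn])+
  let ?f = "\<lambda>P. (\<lambda>i. class_torsion m (P i), \<lambda>i. class_torsion n (P i))"
  let ?g = "\<lambda>(P, Q). \<lambda>i. class_prod (P i) (Q i)"
  have "bij_betw ?f (bounded_group_partitions r ?E)
      (bounded_group_partitions r C \<times> bounded_group_partitions r D)"
  proof (rule bij_betw_byWitness[where f' = ?g])
    show "\<forall>P\<in>bounded_group_partitions r ?E. ?g (?f P) = P"
    proof
      fix P assume "P \<in> bounded_group_partitions r ?E"
      then have P: "group_partition ?E P" by (simp add: bounded_group_partitions_def)
      show "?g (?f P) = P"
        \<comment> \<open>Every factor of \<open>P\<close> has exponent dividing
          \<open>m * n\<close>, so it is the product of its two torsion parts.\<close>
        using class_prod_torsion[OF group_partition_in_iso_classes[OF P]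
            group_partition_bounded_exponent[OF E P exp] mn(1,2)]
        by simp
    qed
    show "\<forall>p\<in>bounded_group_partitions r C \<times> bounded_group_partitions r D. ?f (?g p) = p"
    proof
      fix p assume "p \<in> bounded_group_partitions r C \<times> bounded_group_partitions r D"
      then obtain P Q where p: "p = (P, Q)" and P: "group_partition C P" and Q: "group_partition D Q"
        by (auto simp: bounded_group_partitions_def)
      show "?f (?g p) = p"
        \<comment> \<open>The factors of \<open>P\<close> are killed by \<open>m\<close> and those
          of \<open>Q\<close> by \<open>n\<close>, so torsion recovers both from their
          product.\<close>
        using class_torsion_prod[OF group_partition_in_iso_classes[OF P] group_partition_in_iso_classes[OF Q]
            group_partition_bounded_exponent[OF C(1) P C(2)]
            group_partition_bounded_exponent[OF D(1) Q D(2)] mn]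
        by (simp add: p)
    qed
    show "?f ` bounded_group_partitions r ?E \<subseteq>
        bounded_group_partitions r C \<times> bounded_group_partitions r D"
      using bounded_group_partitions_torsion[OF E, of _ r m] bounded_group_partitions_torsion[OF E, of _ r n]
      unfolding tor by blast
    show "?g ` (bounded_group_partitions r C \<times> bounded_group_partitions r D) \<subseteq>
        bounded_group_partitions r ?E"
      using bounded_group_partitions_prod[OF C(1) D(1)] by auto
  qed
  \<comment> \<open>Transfer along a bijection and the product rule for \<open>card\<close> also
    hold for infinite sets.\<close>
  from bij_betw_same_card[OF this] show ?thesis
    by (simp add: card_cartesian_product num_group_partitions_def bounded_group_partitions_def)
qed

section \<open>Summation over the classes of order \<open>m * n\<close>\<close>

theorem corollary2p4:
  fixes r :: enat and m n :: nat
  assumes "r > 0" and "m > 0" and "n > 0" and "coprime m n"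
  shows "partition_sum r (m * n) = partition_sum r m * partition_sum r n"
proof -
  define S where "S k = {C. C \<in> iso_classes \<and> class_has_order C k}" for k
  have "partition_sum r m * partition_sum r n =
      (\<Sum>(C, D)\<in>S m \<times> S n. num_group_partitions r C * num_group_partitions r D)"
    by (simp add: partition_sum_def S_def sum_product sum.cartesian_product)
  also have "\<dots> = (\<Sum>C\<in>S (m * n). num_group_partitions r C)"
  \<comment> \<open>Pairs of classes of orders \<open>m\<close> and \<open>n\<close> are matched
    with classes of order \<open>m * n\<close> by the direct product, with the two torsion parts as
    inverse.\<close>
  proof (rule sum.reindex_bij_witness[where i = "\<lambda>C. (class_torsion m C, class_torsion n C)"
        and j = "\<lambda>(C, D). class_prod C D"])
    fix p assume "p \<in> S m \<times> S n"
    then obtain C D where p: "p = (C, D)" and C: "C \<in> iso_classes" "class_has_order C m"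
        and D: "D \<in> iso_classes" "class_has_order D n"
      by (auto simp: S_def)
    \<comment> \<open>Orders are turned into exponent bounds, the form in which coprimality was
      exploited.\<close>
    note exp = class_bounded_exponent_order[OF C] class_bounded_exponent_order[OF D]
    have E: "class_prod C D \<in> iso_classes" "class_has_order (class_prod C D) (m * n)"
      using C D by (simp_all add: class_prod_in_iso_classes class_has_order_prod)
    show "(class_torsion m (case p of (C, D) \<Rightarrow> class_prod C D),
        class_torsion n (case p of (C, D) \<Rightarrow> class_prod C D)) = p"
      by (simp add: p class_torsion_prod[OF C(1) D(1) exp assms(4,2,3)])
    show "(case p of (C, D) \<Rightarrow> class_prod C D) \<in> S (m * n)"
      using E by (simp add: p S_def)
    show "num_group_partitions r (case p of (C, D) \<Rightarrow> class_prod C D) =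
        (case p of (C, D) \<Rightarrow> num_group_partitions r C * num_group_partitions r D)"
      by (simp add: p num_group_partitions_prod[OF C(1) exp(1) D(1) exp(2) assms(4,2,3)
            class_bounded_exponent_order[OF E]])
  next
    fix C assume "C \<in> S (m * n)"
    then have C: "C \<in> iso_classes" "class_has_order C (m * n)" by (simp_all add: S_def)
    show "(case (class_torsion m C, class_torsion n C) of (C, D) \<Rightarrow> class_prod C D) = C"
      using class_prod_torsion[OF C(1) class_bounded_exponent_order[OF C] assms(4,2)] by simp
    show "(class_torsion m C, class_torsion n C) \<in> S m \<times> S n"
      using C assms by (simp add: S_def class_torsion_in_iso_classes class_has_order_torsion)
  qed
  finally show ?thesis by (simp add: partition_sum_def S_def)
qed

end
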